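(* As formal power series in $q$, \[ \sum_{n\geq 1} \frac{(-1)^n q^{2n}}{1-q^{4n}}\,\frac{(-q;q^2)_{n-1}}{(q^2;q^2)_{n-1}}\,q^{n-1} \;=\; \frac{1}{1-q}\sum_{n\geq 0} (-1)^n q^{n^2} - \frac{1}{1-q^2}. \]
   Context: For a non-negative integer $L$, $(a;q)_L=\prod_{i=0}^{L-1}(1-aq^i)$ (so $(a;q)_0=1$). *)

theory Defs
  imports
    "HOL-Analysis.Infinite_Sum"
    "HOL-Computational_Algebra.Formal_Power_Series"
begin

definition qpoch :: "'a::comm_ring_1 \<Rightarrow> 'a \<Rightarrow> nat \<Rightarrow> 'a" where
  "qpoch a q L = (\<Prod>i<L. 1 - a * q ^ i)"

end

theory Submission
  imports Defs
begin

text \<open>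
  A special case of the transformation of nonterminating \<open>3\<phi>2\<close> series turns the left-hand side
  into a multiple of \<open>\<Sum>j. q ^ (2j) (q;q)\<^bsub>2j+1\<^esub> / (-q;q)\<^bsub>2j+3\<^esub>\<close>, which telescopes: with
  \<open>P m = (q;q)\<^bsub>m\<^esub> / (-q;q)\<^bsub>m\<^esub>\<close> its terms are multiples of \<open>P (2j+1) - P (2j+3)\<close>. So the left-hand side
  is \<open>(P \<infinity> - P 1) / (2 (1 - q))\<close>, and Gauss's theorem
  \<open>P \<infinity> = 2 (\<Sum>n\<ge>0. (-1) ^ n q ^ (n\<^sup>2)) - 1\<close> finishes the proof. Both the transformation and Gauss's
  theorem come from finite telescoping identities, read modulo powers of \<open>q\<close>.
\<close>

unbundle fps_syntax

section \<open>Infinite sums of formal power series, read modulo powers of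
  \<open>fps_X\<close>\<close>

lemma fps_X_power_dvd_iff:
  fixes f :: "'a::comm_ring_1 fps"
  shows "fps_X ^ N dvd f \<longleftrightarrow> (\<forall>k<N. f $ k = 0)"
proof
  assume "\<forall>k<N. f $ k = 0"
  then have "f = fps_X ^ N * fps_shift N f"
    by (intro fps_ext) (auto simp: fps_X_power_mult_nth)
  then show "fps_X ^ N dvd f" by (metis dvd_triv_left)
qed (auto simp: dvd_def fps_X_power_mult_nth)

lemma fps_X_power_dvd_unit_mult_iff:
  fixes f u :: "'a::field fps"
  assumes "u $ 0 \<noteq> 0"
  shows "fps_X ^ N dvd u * f \<longleftrightarrow> fps_X ^ N dvd f"
  using assms by (simp add: dvd_mult_unit_iff mult.commute[of u])

lemma fps_X_power_dvd_nth_nonzeroD: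
  fixes f :: "'a::comm_ring_1 fps"
  assumes "fps_X ^ n dvd f" "f $ k \<noteq> 0"
  shows "n \<le> k"
  using assms by (meson fps_X_power_dvd_iff not_less)

text \<open>Since \<open>F n\<close> starts at degree \<open>n\<close> or later, only the indices
  \<open>n \<le> k\<close> reach coefficient \<open>k\<close>. Hence each coefficient of the
  infinite sum is a finite sum, and a value can be verified by truncation modulo every
  \<open>fps_X ^ N\<close>.\<close>

lemma has_sum_fps_natI:
  fixes F :: "nat \<Rightarrow> 'a::comm_ring_1 fps"
  assumes dvd: "\<And>n. n \<in> A \<Longrightarrow> fps_X ^ n dvd F n"
    and S: "\<And>N. fps_X ^ N dvd S - sum F (A \<inter> {..<N})"
  shows "(F has_sum S) A"
proof (rule has_sum_fpsI)
  fix k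
  have sub: "{n \<in> A. F n $ k \<noteq> 0} \<subseteq> A \<inter> {..<Suc k}"
    using fps_X_power_dvd_nth_nonzeroD[OF dvd] by (auto simp: less_Suc_eq_le)
  then show "finite {n \<in> A. F n $ k \<noteq> 0}"
    by (rule finite_subset) simp
  have "S $ k = sum F (A \<inter> {..<Suc k}) $ k"
    using S[of "Suc k"] by (simp add: fps_X_power_dvd_iff del: power_Suc)
  also have "\<dots> = (\<Sum>n | n \<in> A \<and> F n $ k \<noteq> 0. F n $ k)"
    unfolding fps_sum_nth by (rule sum.mono_neutral_right) (use sub in auto)
  finally show "S $ k = (\<Sum>n | n \<in> A \<and> F n $ k \<noteq> 0. F n $ k)" .
qed

lemma has_sum_fps_natD:
  fixes F :: "nat \<Rightarrow> 'a::comm_ring_1 fps"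
  assumes dvd: "\<And>n. n \<in> A \<Longrightarrow> fps_X ^ n dvd F n"
    and S: "(F has_sum S) A"
  shows "fps_X ^ N dvd S - sum F (A \<inter> {..<N})"
  unfolding fps_X_power_dvd_iff
proof (intro allI impI)
  fix k assume "k < N"
  then have sub: "{n \<in> A. F n $ k \<noteq> 0} \<subseteq> A \<inter> {..<N}"
    using fps_X_power_dvd_nth_nonzeroD[OF dvd] by (auto intro: le_less_trans)
  have "S $ k = (\<Sum>n | n \<in> A \<and> F n $ k \<noteq> 0. F n $ k)"
    by (rule has_sum_fpsD(2)[OF S])
  also have "\<dots> = sum F (A \<inter> {..<N}) $ k"
    unfolding fps_sum_nth by (rule sum.mono_neutral_left) (use sub in auto)
  finally show "(S - sum F (A \<inter> {..<N})) $ k = 0" by simp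
qed

text \<open>Coefficient \<open>k\<close> of the partial sums no longer changes once the indices up
  to \<open>k\<close> are included, so the limit can be written down coefficient by
  coefficient.\<close>

lemma summable_on_fps_nat:
  fixes F :: "nat \<Rightarrow> 'a::comm_ring_1 fps"
  assumes dvd: "\<And>n. n \<in> A \<Longrightarrow> fps_X ^ n dvd F n"
  shows "F summable_on A"
proof -
  define S where "S = Abs_fps (\<lambda>k. sum F (A \<inter> {..<Suc k}) $ k)"
  have "(F has_sum S) A"
  proof (rule has_sum_fps_natI[OF dvd])
    fix N
    have "sum F (A \<inter> {..<N}) $ k = sum F (A \<inter> {..<Suc k}) $ k" if "k < N" for k
      unfolding fps_sum_nth using that fps_X_power_dvd_nth_nonzeroD[OF dvd]
      by (intro sum.mono_neutral_right) (auto simp: less_Suc_eq_le)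
    then show "fps_X ^ N dvd S - sum F (A \<inter> {..<N})"
      by (simp add: fps_X_power_dvd_iff S_def)
  qed
  then show ?thesis by (auto simp: summable_on_def)
qed

section \<open>q-Pochhammer symbols and the finite form of Gauss's theorem\<close>

lemma qpoch_0 [simp]: "qpoch a q 0 = 1"
  by (simp add: qpoch_def)

lemma qpoch_Suc: "qpoch a q (Suc n) = qpoch a q n * (1 - a * q ^ n)"
  by (simp add: qpoch_def)

lemma qpoch_nth_0:
  fixes a q :: "'a::comm_ring_1 fps"
  assumes "a $ 0 = 0"
  shows "qpoch a q n $ 0 = 1"
  using assms by (induction n) (simp_all add: qpoch_Suc)

text \<open>This is \<open>P n\<close> of the overview, the quotient of (q;q)_n by (-q;q)_n at q =
  \<open>fps_X\<close>.\<close>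

definition gauss_prod :: "nat \<Rightarrow> 'a::field fps" where
  "gauss_prod n = (\<Prod>k<n. (1 - fps_X ^ Suc k) * inverse (1 + fps_X ^ Suc k))"

lemma gauss_prod_Suc:
  "gauss_prod (Suc n) = gauss_prod n * ((1 - fps_X ^ Suc n) * inverse (1 + fps_X ^ Suc n))"
  by (simp add: gauss_prod_def)

lemma gauss_prod_nth_0: "gauss_prod n $ 0 = 1"
  by (induction n) (simp_all add: gauss_prod_def)

text \<open>Lowers the index in the denominator when the certificate \<open>H\<close> below is
  evaluated at \<open>Suc s\<close>.\<close>

lemma inverse_gauss_prod_Suc:
  "(1 - fps_X ^ Suc n) * inverse (gauss_prod (Suc n)) * inverse (1 + fps_X ^ Suc n)
    = inverse (gauss_prod n :: 'a::field fps)"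
proof -
  define x where "x = (fps_X :: 'a fps) ^ Suc n"
  have [simp]: "x $ 0 = 0" by (simp add: x_def)
  have "(1 - x) * inverse (1 - x) = 1" "(1 + x) * inverse (1 + x) = 1"
    by (auto intro!: inverse_mult_eq_1')
  moreover have "inverse (gauss_prod (Suc n)) = inverse (gauss_prod n) * (inverse (1 - x) * (1 + x))"
    unfolding gauss_prod_Suc x_def[symmetric] by (simp add: fps_inverse_mult)
  ultimately show ?thesis
    unfolding x_def[symmetric] by algebra
qed

text \<open>Induction on \<open>n\<close>: the change of the left-hand summand from \<open>n\<close>
  to \<open>n + 1\<close> telescopes in \<open>s\<close>, so the whole sum grows by boundary terms
  only, and these amount to one new theta term.\<close>

lemma shanks_identity:
  "(\<Sum>s\<le>n. 2 * (-1) ^ s * fps_X ^ (s * Suc n) * gauss_prod n * inverse (gauss_prod s) * inverse (1 + fps_X ^ s))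
    = (2 * (\<Sum>s\<le>n. (-1) ^ s * fps_X ^ (s ^ 2)) - 1 :: 'a::field_char_0 fps)"
proof (induction n)
  case 0
  \<comment> \<open>At \<open>s = 0\<close> the denominator \<open>1 + fps_X ^ s\<close> is 2, which
    is a unit in characteristic 0.\<close>
  have "2 * inverse (2 :: 'a fps) = 1"
    by (rule inverse_mult_eq_1') (simp add: fps_numeral_nth)
  then show ?case by (simp add: gauss_prod_def)
next
  case (Suc n)
  define A where "A s n = 2 * (-1) ^ s * fps_X ^ (s * Suc n) * gauss_prod n * inverse (gauss_prod s) *
    inverse (1 + fps_X ^ s :: 'a fps)" for s n
  \<comment> \<open>\<open>H\<close> is the antidifference in \<open>s\<close> of
    \<open>A s (Suc n) - A s n\<close>. Its factor \<open>1 - fps_X ^ s\<close> makes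
    \<open>H 0\<close> vanish, so the telescoped sum is \<open>H (Suc n)\<close> alone.\<close>
  define H where "H s = 2 * (-1) ^ s * fps_X ^ (s * Suc n) * (1 - fps_X ^ s) * inverse (gauss_prod s) *
    inverse (1 + fps_X ^ s) * gauss_prod n * inverse (1 + fps_X ^ Suc n :: 'a fps)" for s
  have diff: "A s (Suc n) - A s n = H (Suc s) - H s" for s
  proof -
    define e where "e = (- 1 :: 'a fps) ^ s"
    define x where "x = (fps_X :: 'a fps) ^ s"
    define y where "y = (fps_X :: 'a fps) ^ Suc n"
    define X where "X = (fps_X :: 'a fps) ^ (s * Suc n)"
    define u where "u = inverse (1 + x)"
    define v where "v = inverse (1 + y)"
    define g where "g = (gauss_prod n :: 'a fps)"
    define I where "I = inverse (gauss_prod s :: 'a fps)"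
    have u: "(1 + x) * u = 1"
      unfolding u_def by (rule inverse_mult_eq_1') (cases s; simp add: x_def)
    have v: "(1 + y) * v = 1"
      unfolding v_def by (rule inverse_mult_eq_1') (simp add: y_def)
    have "A s n = 2 * e * X * g * I * u"
      by (simp add: A_def e_def X_def g_def I_def u_def x_def)
    moreover have "A s (Suc n) = 2 * e * (X * x) * (g * ((1 - y) * v)) * I * u"
    proof -
      have "(fps_X :: 'a fps) ^ (s * Suc (Suc n)) = X * x"
        unfolding X_def x_def power_add[symmetric] by (simp add: algebra_simps)
      then show ?thesis
        unfolding A_def gauss_prod_Suc e_def I_def g_def u_def v_def x_def y_def by simp
    qed
    moreover have "H s = 2 * e * X * (1 - x) * I * u * g * v"
      by (simp add: H_def e_def X_def g_def I_def u_def x_def v_def y_def)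
    moreover have "H (Suc s) = 2 * (- e) * (X * y) * I * g * v"
    proof -
      have "(fps_X :: 'a fps) ^ (Suc s * Suc n) = X * y"
        unfolding X_def y_def power_add[symmetric] by (simp add: algebra_simps)
      then have "H (Suc s) = 2 * (- e) * (X * y) * ((1 - fps_X ^ Suc s) *
          inverse (gauss_prod (Suc s)) * inverse (1 + fps_X ^ Suc s)) * g * v"
        unfolding H_def e_def g_def v_def y_def by (simp only: power_Suc mult.assoc) simp
      then show ?thesis
        unfolding inverse_gauss_prod_Suc I_def .
    qed
    ultimately show ?thesis using u v by algebra
  qed
  have "(\<Sum>s\<le>n. A s (Suc n)) - (\<Sum>s\<le>n. A s n) = (\<Sum>s<Suc n. H (Suc s) - H s)"
    unfolding lessThan_Suc_atMost by (simp add: sum_subtractf[symmetric] diff)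
  also have "\<dots> = H (Suc n)"
    by (subst sum_lessThan_telescope) (simp add: H_def)
  finally have "(\<Sum>s\<le>Suc n. A s (Suc n)) = (\<Sum>s\<le>n. A s n) + (H (Suc n) + A (Suc n) (Suc n))"
    by (simp add: algebra_simps)
  \<comment> \<open>The telescoped boundary and the new top summand have the common factor
    \<open>(1 - y) * v * g * I\<close>, which is 1; what remains is \<open>(1 + y) * v\<close>,
    again 1.\<close>
  also have "H (Suc n) + A (Suc n) (Suc n) = 2 * (-1) ^ Suc n * fps_X ^ ((Suc n)\<^sup>2)"
  proof -
    define y where "y = (fps_X :: 'a fps) ^ Suc n"
    define g where "g = (gauss_prod n :: 'a fps)"
    define I where "I = inverse (gauss_prod (Suc n) :: 'a fps)"
    define v where "v = inverse (1 + y)"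
    define X where "X = (fps_X :: 'a fps) ^ (Suc n * Suc n)"
    define e where "e = (- 1 :: 'a fps) ^ Suc n"
    have v: "(1 + y) * v = 1"
      unfolding v_def by (rule inverse_mult_eq_1') (simp add: y_def)
    have I: "g * ((1 - y) * v) * I = 1"
      unfolding g_def v_def y_def I_def gauss_prod_Suc[symmetric]
      by (rule inverse_mult_eq_1') (simp add: gauss_prod_nth_0)
    have "H (Suc n) = 2 * e * X * (1 - y) * I * v * g * v"
      unfolding H_def e_def X_def g_def I_def v_def y_def ..
    moreover have "A (Suc n) (Suc n) = 2 * e * (X * y) * (g * ((1 - y) * v)) * I * v"
    proof -
      have "(fps_X :: 'a fps) ^ (Suc n * Suc (Suc n)) = X * y"
        unfolding X_def y_def power_add[symmetric] by (simp add: algebra_simps)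
      then show ?thesis
        unfolding A_def gauss_prod_Suc[of n] e_def I_def g_def v_def y_def by simp
    qed
    ultimately have "H (Suc n) + A (Suc n) (Suc n) = 2 * e * X"
      using v I by algebra
    then show ?thesis by (simp only: e_def X_def power2_eq_square)
  qed
  finally show ?case
    using Suc.IH unfolding A_def by (simp add: algebra_simps)
qed

text \<open>In \<open>shanks_identity\<close> the summand at \<open>s = 0\<close> is
  \<open>gauss_prod n\<close> itself, and every later one contains
  \<open>fps_X ^ (s * Suc n)\<close>, hence vanishes modulo \<open>fps_X ^ Suc n\<close>.\<close>

lemma gauss_prod_cong_theta:
  "fps_X ^ Suc n dvd (gauss_prod n - (2 * (\<Sum>s\<le>n. (-1) ^ s * fps_X ^ (s ^ 2)) - 1) :: 'a::field_char_0 fps)"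
proof -
  define A where "A s = 2 * (-1) ^ s * fps_X ^ (s * Suc n) * gauss_prod n * inverse (gauss_prod s) *
    inverse (1 + fps_X ^ s :: 'a fps)" for s
  have "2 * inverse (2 :: 'a fps) = 1"
    by (rule inverse_mult_eq_1') (simp add: fps_numeral_nth)
  then have A0: "A 0 = gauss_prod n"
    by (simp add: A_def gauss_prod_def algebra_simps)
  have "sum A {..n} = A 0 + (\<Sum>s<n. A (Suc s))"
    by (rule sum.atMost_shift)
  moreover have "fps_X ^ Suc n dvd A (Suc s)" for s
  proof -
    have "(fps_X :: 'a fps) ^ Suc n dvd fps_X ^ (Suc s * Suc n)"
      by (rule le_imp_power_dvd) simp
    then show ?thesis unfolding A_def by (intro dvd_mult2 dvd_mult)
  qed
  ultimately have "fps_X ^ Suc n dvd sum A {..n} - gauss_prod n"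
    using A0 by (auto intro!: dvd_sum)
  then show ?thesis
    unfolding A_def shanks_identity by (subst dvd_diff_commute)
qed

section \<open>A WZ pair for the left-hand side\<close>

text \<open>
  The summand at \<open>j = 0\<close> is embedded in the family obtained from
  \<open>3\<phi>2(q\<^sup>2, -q, -q\<^sup>2; -q ^ (4+2j), q ^ 4; q\<^sup>2, -q ^ (3+2j))\<close>, rescaled so that consecutive members of
  the family differ by the boundary term \<open>wz_G 0 j\<close>.
\<close>
definition wz_F :: "nat \<Rightarrow> nat \<Rightarrow> 'a::field fps" where
  "wz_F n j = - (fps_X\<^sup>2 * (1 + fps_X) * inverse (1 - fps_X)) * (-1) ^ n * fps_X ^ (3 * n + 2 * j + 2 * j * n) *
     qpoch (- fps_X) (fps_X\<^sup>2) n * qpoch (- (fps_X\<^sup>2)) (fps_X\<^sup>2) n *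
     qpoch fps_X (fps_X\<^sup>2) (Suc j) * qpoch (fps_X\<^sup>2) (fps_X\<^sup>2) j *
     inverse (qpoch (fps_X\<^sup>2) (fps_X\<^sup>2) (Suc n)) *
     inverse (qpoch (- (fps_X\<^sup>2)) (fps_X\<^sup>2) (Suc (n + j))) *
     inverse (qpoch (- fps_X) (fps_X\<^sup>2) (Suc j))"

text \<open>The WZ mate of \<open>wz_F\<close>. Its factor \<open>1 - fps_X ^ (2 * n + 2)\<close>
  would vanish only at n = -1, so the edge \<open>n = 0\<close> survives and carries the value of
  the sum.\<close>

definition wz_G :: "nat \<Rightarrow> nat \<Rightarrow> 'a::field fps" where
  "wz_G n j = wz_F n j * (1 - fps_X ^ (2 * n + 2)) * inverse (1 + fps_X ^ (2 * j + 3))"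

text \<open>\<open>wz_F\<close> is q-hypergeometric in both indices. This ratio in \<open>j\<close>
  and the following one in \<open>n\<close> reduce the WZ equation to an identity of rational
  functions.\<close>

lemma wz_F_Suc_right:
  "wz_F n (Suc j) = wz_F n j * (fps_X ^ (2 * n + 2) * (1 - fps_X ^ (2 * j + 3)) * (1 - fps_X ^ (2 * j + 2)) *
     inverse (1 + fps_X ^ (2 * n + 2 * j + 4)) * inverse (1 + fps_X ^ (2 * j + 3)))"
proof -
  have "(fps_X :: 'a fps) ^ (3 * n + 2 * Suc j + 2 * Suc j * n) = fps_X ^ (3 * n + 2 * j + 2 * j * n) * fps_X ^ (2 * n + 2)"
    unfolding power_add[symmetric] by (simp add: algebra_simps)
  moreover have "fps_X * (fps_X\<^sup>2) ^ Suc j = (fps_X :: 'a fps) ^ (2 * j + 3)"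
    "fps_X\<^sup>2 * (fps_X\<^sup>2) ^ j = (fps_X :: 'a fps) ^ (2 * j + 2)"
    "fps_X\<^sup>2 * (fps_X\<^sup>2) ^ Suc (n + j) = (fps_X :: 'a fps) ^ (2 * n + 2 * j + 4)"
    by (simp_all add: power_mult[symmetric] power_add[symmetric] power_Suc[symmetric] algebra_simps eval_nat_numeral del: power_Suc)
  ultimately show ?thesis
    unfolding wz_F_def add_Suc_right qpoch_Suc[of _ _ "Suc j"] qpoch_Suc[of _ _ j] qpoch_Suc[of _ _ "Suc (n + j)"]
    by (simp only: fps_inverse_mult mult_minus_left minus_mult_minus diff_minus_eq_add mult_ac)
qed

lemma wz_F_Suc_left:
  "wz_F (Suc n) j = - wz_F n j * (fps_X ^ (2 * j + 3) * (1 + fps_X ^ (2 * n + 1)) * (1 + fps_X ^ (2 * n + 2)) *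
     inverse (1 - fps_X ^ (2 * n + 4)) * inverse (1 + fps_X ^ (2 * n + 2 * j + 4)))"
proof -
  have "(fps_X :: 'a fps) ^ (3 * Suc n + 2 * j + 2 * j * Suc n) = fps_X ^ (3 * n + 2 * j + 2 * j * n) * fps_X ^ (2 * j + 3)"
    unfolding power_add[symmetric] by (simp add: algebra_simps)
  moreover have "fps_X * (fps_X\<^sup>2) ^ n = (fps_X :: 'a fps) ^ (2 * n + 1)"
    "fps_X\<^sup>2 * (fps_X\<^sup>2) ^ n = (fps_X :: 'a fps) ^ (2 * n + 2)"
    "fps_X\<^sup>2 * (fps_X\<^sup>2) ^ Suc n = (fps_X :: 'a fps) ^ (2 * n + 4)"
    "fps_X\<^sup>2 * (fps_X\<^sup>2) ^ Suc (n + j) = (fps_X :: 'a fps) ^ (2 * n + 2 * j + 4)"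
    by (simp_all add: power_mult[symmetric] power_add[symmetric] power_Suc[symmetric] algebra_simps eval_nat_numeral del: power_Suc)
  ultimately show ?thesis
    unfolding wz_F_def add_Suc qpoch_Suc[of _ _ "Suc n"] qpoch_Suc[of _ _ n] qpoch_Suc[of _ _ "Suc (n + j)"]
    by (simp only: fps_inverse_mult mult_minus_left minus_mult_minus diff_minus_eq_add mult_ac power_Suc mult_minus_right minus_minus mult_1_left)
qed

lemma wz_pair:
  "wz_F n j - wz_F n (Suc j) = wz_G n j - (wz_G (Suc n) j :: 'a::field fps)"
proof -
  define q where "q = (fps_X :: 'a fps)"
  define Y where "Y = q ^ (2 * j)"
  define Z where "Z = q ^ (2 * n)"
  have pow: "q ^ (2 * j + 3) = q ^ 3 * Y" "q ^ (2 * j + 2) = q ^ 2 * Y" "q ^ (2 * n + 1) = q * Z"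
    "q ^ (2 * n + 2) = q ^ 2 * Z" "q ^ (2 * n + 4) = q ^ 4 * Z" "q ^ (2 * Suc n + 2) = q ^ 4 * Z"
    "q ^ (2 * n + 2 * j + 4) = q ^ 4 * Y * Z"
    unfolding Y_def Z_def power_add[symmetric] power_Suc[symmetric] by (simp_all add: algebra_simps eval_nat_numeral)
  define v where "v = inverse (1 + q ^ 3 * Y)"
  define w where "w = inverse (1 + q ^ 4 * Y * Z)"
  define t where "t = inverse (1 - q ^ 4 * Z)"
  define F where "F = (wz_F n j :: 'a fps)"
  have v: "(1 + q ^ 3 * Y) * v = 1"
    unfolding v_def by (rule inverse_mult_eq_1') (simp add: q_def)
  have w: "(1 + q ^ 4 * Y * Z) * w = 1"
    unfolding w_def by (rule inverse_mult_eq_1') (simp add: q_def)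
  have t: "(1 - q ^ 4 * Z) * t = 1"
    unfolding t_def by (rule inverse_mult_eq_1') (simp add: q_def)
  define K where "K = q ^ 2 * Z * (1 - q ^ 3 * Y) * (1 - q ^ 2 * Y) * w * v"
  define L where "L = (1 - q ^ 2 * Z) * v"
  define M where "M = q ^ 3 * Y * (1 + q * Z) * (1 + q ^ 2 * Z) * w * v"
  \<comment> \<open>This is the WZ equation divided by \<open>wz_F n j\<close>. Factors equal to 1
    are left unreduced so that every term contains \<open>v * w\<close>; apart from this common
    factor it is a polynomial identity in \<open>q\<close>, \<open>Y\<close> and
    \<open>Z\<close>.\<close>
  have "((1 + q ^ 3 * Y) * v) * ((1 + q ^ 4 * Y * Z) * w) - q ^ 2 * Z * (1 - q ^ 3 * Y) * (1 - q ^ 2 * Y) * w * v =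
      (1 - q ^ 2 * Z) * v * ((1 + q ^ 4 * Y * Z) * w) + q ^ 3 * Y * (1 + q * Z) * (1 + q ^ 2 * Z) * w * v"
    by algebra
  then have KLM: "1 - K = L + M"
    unfolding v w K_def L_def M_def by simp
  have K: "wz_F n (Suc j) = F * K"
    unfolding wz_F_Suc_right q_def[symmetric] pow F_def w_def v_def K_def ..
  have L: "wz_G n j = F * L"
    unfolding wz_G_def q_def[symmetric] pow F_def v_def L_def by (rule mult.assoc)
  have "wz_G (Suc n) j = - F * M * ((1 - q ^ 4 * Z) * t)"
    unfolding wz_G_def wz_F_Suc_left q_def[symmetric] pow F_def w_def v_def t_def M_def
    by (simp only: mult_ac)
  then have M: "wz_G (Suc n) j = - F * M"
    by (simp add: t)
  have "F * (1 - K) = F * (L + M)"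
    by (simp only: KLM)
  then show ?thesis
    unfolding K L M F_def[symmetric] by (simp add: algebra_simps)
qed

text \<open>Summing \<open>wz_pair\<close> over the rectangle \<open>n < N\<close>,
  \<open>j < M\<close> telescopes in \<open>j\<close> on one side and in \<open>n\<close> on the
  other, leaving the four edges.\<close>

lemma wz_sum:
  "(\<Sum>n<N. wz_F n 0) - (\<Sum>n<N. wz_F n M) = (\<Sum>j<M. wz_G 0 j) - (\<Sum>j<M. wz_G N j :: 'a::field fps)"
proof -
  have "(\<Sum>n<N. wz_F n 0) - (\<Sum>n<N. wz_F n M) = (\<Sum>n<N. \<Sum>j<M. wz_F n j - wz_F n (Suc j) :: 'a fps)"
    by (simp only: sum_subtractf[symmetric] sum_lessThan_telescope')
  also have "\<dots> = (\<Sum>j<M. \<Sum>n<N. wz_G n j - wz_G (Suc n) j)"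
    unfolding wz_pair by (rule sum.swap)
  also have "\<dots> = (\<Sum>j<M. wz_G 0 j) - (\<Sum>j<M. wz_G N j)"
    by (simp only: sum_subtractf[symmetric] sum_lessThan_telescope'[of "\<lambda>n. wz_G n j" for j])
  finally show ?thesis .
qed

text \<open>This order bound makes the far edges \<open>j = M\<close> and \<open>n = N\<close> of
  the rectangle negligible.\<close>

lemma fps_X_power_dvd_wz_F: "fps_X ^ (3 * n + 2 * j + 2) dvd wz_F n j"
proof -
  have "fps_X\<^sup>2 * fps_X ^ (3 * n + 2 * j + 2 * j * n) dvd wz_F n j"
    unfolding wz_F_def by (intro dvd_mult2 mult_dvd_mono) auto
  moreover have "fps_X ^ (3 * n + 2 * j + 2) dvd fps_X\<^sup>2 * (fps_X :: 'a fps) ^ (3 * n + 2 * j + 2 * j * n)"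
    unfolding power_add[symmetric] by (rule le_imp_power_dvd) simp
  ultimately show ?thesis by (rule dvd_trans[rotated])
qed

section \<open>Evaluation of the edges \<open>n = 0\<close> and \<open>j = 0\<close>\<close>

text \<open>Splitting by the parity of the exponent: (q;q)_{2j+1} = (q;q^2)_{j+1} (q^2;q^2)_j, and
  likewise for (-q;q)_{2j+1}.\<close>

lemma gauss_prod_odd:
  "qpoch fps_X (fps_X\<^sup>2) (Suc j) * qpoch (fps_X\<^sup>2) (fps_X\<^sup>2) j *
     inverse (qpoch (- (fps_X\<^sup>2)) (fps_X\<^sup>2) j) * inverse (qpoch (- fps_X) (fps_X\<^sup>2) (Suc j))
    = (gauss_prod (2 * j + 1) :: 'a::field fps)"
proof (induction j)
  case 0
  show ?case by (simp add: qpoch_Suc gauss_prod_def)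
next
  case (Suc j)
  define q where "q = (fps_X :: 'a fps)"
  have pow: "q * (q\<^sup>2) ^ Suc j = q ^ Suc (Suc (2 * j + 1))" "q\<^sup>2 * (q\<^sup>2) ^ j = q ^ Suc (2 * j + 1)"
    by (simp_all add: power_mult[symmetric] power_add[symmetric] power_Suc[symmetric] algebra_simps eval_nat_numeral del: power_Suc)
  have "2 * Suc j + 1 = Suc (Suc (2 * j + 1))" by simp
  then have "gauss_prod (2 * Suc j + 1) = gauss_prod (2 * j + 1) *
      ((1 - q ^ Suc (2 * j + 1)) * inverse (1 + q ^ Suc (2 * j + 1))) *
      ((1 - q ^ Suc (Suc (2 * j + 1))) * inverse (1 + q ^ Suc (Suc (2 * j + 1))))"
    by (simp only: gauss_prod_Suc q_def)
  then show ?case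
    unfolding Suc.IH[symmetric] q_def[symmetric] qpoch_Suc[of _ _ "Suc j"] qpoch_Suc[of "q\<^sup>2" _ j]
      qpoch_Suc[of "- (q\<^sup>2)" _ j] mult_minus_left pow
    by (simp only: fps_inverse_mult diff_minus_eq_add mult_ac)
qed

text \<open>With a = q^(2j+2) and b = q^(2j+3), P (2j+3) - P (2j+1) equals P (2j+1) times -2(a+b) /
  ((1+a)(1+b)), and a + b = q^(2j+2) (1+q). This accounts for the factor 2 and for the prefactor in
  \<open>wz_F\<close>.\<close>

lemma wz_G_0:
  "2 * wz_G 0 j = inverse (1 - fps_X) * (gauss_prod (2 * Suc j + 1) - gauss_prod (2 * j + 1) :: 'a::field fps)"
proof -
  define q where "q = (fps_X :: 'a fps)"
  define Y where "Y = q ^ (2 * j)"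
  define P where "P = (gauss_prod (2 * j + 1) :: 'a fps)"
  define r where "r = inverse (1 - q)"
  define u where "u = inverse (1 + q\<^sup>2 * Y)"
  define v where "v = inverse (1 + q ^ 3 * Y)"
  define t where "t = inverse (1 - q\<^sup>2)"
  have u: "(1 + q\<^sup>2 * Y) * u = 1"
    unfolding u_def by (rule inverse_mult_eq_1') (simp add: q_def)
  have v: "(1 + q ^ 3 * Y) * v = 1"
    unfolding v_def by (rule inverse_mult_eq_1') (simp add: q_def)
  have t: "(1 - q\<^sup>2) * t = 1"
    unfolding t_def by (rule inverse_mult_eq_1') (simp add: q_def)
  have pow: "q ^ (2 * j + 3) = q ^ 3 * Y" "q\<^sup>2 * (q\<^sup>2) ^ j = q\<^sup>2 * Y"
    "q ^ Suc (2 * j + 1) = q\<^sup>2 * Y" "q ^ Suc (Suc (2 * j + 1)) = q ^ 3 * Y"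
    unfolding Y_def power_add[symmetric] power_mult[symmetric] power_Suc[symmetric]
    by (simp_all add: algebra_simps eval_nat_numeral)
  have "wz_F 0 j = - (q\<^sup>2 * (1 + q) * r) * Y * P * t * u"
  proof -
    have Q1: "qpoch (- (q\<^sup>2)) (q\<^sup>2) (Suc (0 + j)) = qpoch (- (q\<^sup>2)) (q\<^sup>2) j * (1 + q\<^sup>2 * Y)"
      unfolding qpoch_Suc add_0 mult_minus_left pow by simp
    have Q2: "qpoch (q\<^sup>2) (q\<^sup>2) (Suc 0) = 1 - q\<^sup>2"
      by (simp add: qpoch_Suc)
    have Q3: "q ^ (3 * 0 + 2 * j + 2 * j * 0) = Y"
      by (simp add: Y_def)
    show ?thesis
      unfolding P_def gauss_prod_odd[symmetric] wz_F_def q_def[symmetric] r_def t_def u_def Q1 Q2 Q3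
        fps_inverse_mult power_0 qpoch_0
      by (simp only: mult_1_right mult_1_left mult_minus_left mult_ac)
  qed
  then have "wz_G 0 j = - (q\<^sup>2 * (1 + q) * r) * Y * P * t * u * (1 - q\<^sup>2) * v"
    unfolding wz_G_def q_def[symmetric] v_def pow by (simp only: mult_0_right add_0)
  moreover have "gauss_prod (2 * Suc j + 1) = P * ((1 - q\<^sup>2 * Y) * u) * ((1 - q ^ 3 * Y) * v)"
  proof -
    have "2 * Suc j + 1 = Suc (Suc (2 * j + 1))" by simp
    then show ?thesis
      unfolding P_def u_def v_def pow(3,4)[symmetric]
      unfolding q_def by (simp only: gauss_prod_Suc)
  qed
  ultimately show ?thesis
    unfolding q_def[symmetric] r_def[symmetric] P_def[symmetric] using u v t by algebra
qed

text \<open>The right-hand side is the summand of the theorem at \<open>Suc n\<close>, since that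
  series starts at index 1. The prefactor (1+q)/(1-q) cancels against the two symbols of length
  \<open>Suc 0\<close>.\<close>

lemma wz_F_0_right:
  "wz_F n 0 = (-1) ^ Suc n * fps_X ^ (2 * Suc n) / (1 - fps_X ^ (4 * Suc n)) *
     (qpoch (- fps_X) (fps_X\<^sup>2) n / qpoch (fps_X\<^sup>2) (fps_X\<^sup>2) n) * fps_X ^ n"
proof -
  define q where "q = (fps_X :: 'a fps)"
  define Z where "Z = q ^ (2 * n)"
  define A where "A = qpoch (- (q\<^sup>2)) (q\<^sup>2) n"
  define I where "I = inverse A"
  define r where "r = inverse (1 - q)"
  define i where "i = inverse (1 + q)"
  define u where "u = inverse (1 - q\<^sup>2 * Z)"
  define v where "v = inverse (1 + q\<^sup>2 * Z)"
  have A: "A * I = 1"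
    unfolding I_def by (rule inverse_mult_eq_1') (simp add: A_def q_def qpoch_nth_0)
  have r: "(1 - q) * r = 1"
    unfolding r_def by (rule inverse_mult_eq_1') (simp add: q_def)
  have i: "(1 + q) * i = 1"
    unfolding i_def by (rule inverse_mult_eq_1') (simp add: q_def)
  have pow: "q ^ (3 * n + 2 * 0 + 2 * 0 * n) = Z * q ^ n" "q\<^sup>2 * (q\<^sup>2) ^ n = q\<^sup>2 * Z" "q ^ (2 * Suc n) = q\<^sup>2 * Z"
    unfolding Z_def power_add[symmetric] power_mult[symmetric] by simp_all
  have "1 - q ^ (4 * Suc n) = (1 - q\<^sup>2 * Z) * (1 + q\<^sup>2 * Z)"
    unfolding Z_def by (simp add: algebra_simps power_add[symmetric] power2_eq_square eval_nat_numeral)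
  then have D: "inverse (1 - q ^ (4 * Suc n)) = u * v"
    by (simp add: fps_inverse_mult u_def v_def)
  have "wz_F n 0 = - (q\<^sup>2 * (1 + q) * r) * (-1) ^ n * (Z * q ^ n) * qpoch (- q) (q\<^sup>2) n * A * (1 - q) *
      (inverse (qpoch (q\<^sup>2) (q\<^sup>2) n) * u) * (I * v) * i"
  proof -
    have "qpoch (q\<^sup>2) (q\<^sup>2) (Suc n) = qpoch (q\<^sup>2) (q\<^sup>2) n * (1 - q\<^sup>2 * Z)"
      unfolding qpoch_Suc pow ..
    moreover have "qpoch (- (q\<^sup>2)) (q\<^sup>2) (Suc (n + 0)) = A * (1 + q\<^sup>2 * Z)"
      unfolding qpoch_Suc add_0_right mult_minus_left pow A_def by simp
    moreover have "qpoch q (q\<^sup>2) (Suc 0) = 1 - q" "qpoch (- q) (q\<^sup>2) (Suc 0) = 1 + q"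
      by (simp_all add: qpoch_Suc)
    ultimately show ?thesis
      unfolding wz_F_def q_def[symmetric] pow(1) I_def r_def i_def u_def v_def A_def
      by (simp only: fps_inverse_mult qpoch_0 mult_1_right)
  qed
  also have "\<dots> = (-1) ^ Suc n * (q\<^sup>2 * Z) * (u * v) * (qpoch (- q) (q\<^sup>2) n * inverse (qpoch (q\<^sup>2) (q\<^sup>2) n)) * q ^ n"
  proof -
    have "- (q\<^sup>2 * (1 + q) * r) * e * (Z * X) * a * A * (1 - q) * (b * u) * (I * v) * i =
        - 1 * e * (q\<^sup>2 * Z) * (u * v) * (a * b) * X" for e X a b
      using A r i by algebra
    then show ?thesis unfolding power_Suc .
  qed
  also have "\<dots> = (-1) ^ Suc n * q ^ (2 * Suc n) / (1 - q ^ (4 * Suc n)) *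
     (qpoch (- q) (q\<^sup>2) n / qpoch (q\<^sup>2) (q\<^sup>2) n) * q ^ n"
    unfolding D[symmetric] pow(3)[symmetric]
    by (subst (1 2) fps_divide_unit) (simp_all add: q_def qpoch_nth_0 zero_power)
  finally show ?thesis unfolding q_def .
qed

section \<open>Passage to the infinite series\<close>

theorem theorem5p4:
  fixes q :: "'a::field_char_0 fps"
  assumes "q = fps_X"
  shows "(\<lambda>n. (-1) ^ n * q ^ (2 * n) / (1 - q ^ (4 * n)) *
              (qpoch (- q) (q ^ 2) (n - 1) / qpoch (q ^ 2) (q ^ 2) (n - 1)) * q ^ (n - 1))
            summable_on {n::nat. n \<ge> 1} \<and>
         (\<lambda>n. (-1) ^ n * q ^ (n ^ 2)) summable_on {n::nat. n \<ge> 0} \<and>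
         (\<Sum>\<^sub>\<infinity>n\<in>{n::nat. n \<ge> 1}.
            (-1) ^ n * q ^ (2 * n) / (1 - q ^ (4 * n)) *
              (qpoch (- q) (q ^ 2) (n - 1) / qpoch (q ^ 2) (q ^ 2) (n - 1)) * q ^ (n - 1)) =
         1 / (1 - q) * (\<Sum>\<^sub>\<infinity>n\<in>{n::nat. n \<ge> 0}. (-1) ^ n * q ^ (n ^ 2)) - 1 / (1 - q ^ 2)"
proof -
  define f where "f n = (-1) ^ n * q ^ (2 * n) / (1 - q ^ (4 * n)) *
    (qpoch (- q) (q ^ 2) (n - 1) / qpoch (q ^ 2) (q ^ 2) (n - 1)) * q ^ (n - 1)" for n
  define \<theta> where "\<theta> n = (-1) ^ n * q ^ (n ^ 2)" for n
  define Z where "Z = infsum \<theta> {n::nat. n \<ge> 0}"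
  define r where "r = inverse (1 - q)"
  define i where "i = inverse (1 + q)"
  have f_Suc: "f (Suc n) = wz_F n 0" for n
    by (simp add: f_def wz_F_0_right assms)
  have \<theta>_dvd: "fps_X ^ n dvd \<theta> n" for n
    unfolding \<theta>_def assms by (intro dvd_mult le_imp_power_dvd) (simp add: power2_nat_le_imp_le)
  have \<theta>_sum: "\<theta> summable_on {n::nat. n \<ge> 0}"
    by (rule summable_on_fps_nat[OF \<theta>_dvd])
  have Z: "fps_X ^ N dvd Z - sum \<theta> {..<N}" for N
    using has_sum_fps_natD[OF \<theta>_dvd has_sum_infsum[OF \<theta>_sum]] by (simp add: Z_def)
  have r: "(1 - q) * r = 1"
    unfolding r_def by (rule inverse_mult_eq_1') (simp add: assms)
  have i: "(1 + q) * i = 1"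
    unfolding i_def by (rule inverse_mult_eq_1') (simp add: assms)
  have "(f has_sum (r * Z - r * i)) {n. n \<ge> 1}"
  proof (rule has_sum_fps_natI)
    fix n :: nat assume "n \<in> {n. n \<ge> 1}"
    then obtain m where m: "n = Suc m" by (cases n) auto
    have "fps_X ^ n dvd (fps_X :: 'a fps) ^ (3 * m + 2 * 0 + 2)"
      unfolding m by (rule le_imp_power_dvd) simp
    then show "fps_X ^ n dvd f n"
      unfolding m f_Suc using fps_X_power_dvd_wz_F dvd_trans by blast
  next
    fix N :: nat
    show "fps_X ^ N dvd r * Z - r * i - sum f ({n. n \<ge> 1} \<inter> {..<N})"
    proof (cases N)
      \<comment> \<open>For N = M + 1 the truncated series has the M terms \<open>wz_F n 0\<close>
        with \<open>n < M\<close>, so \<open>wz_sum\<close> is used on the M by M square. Taking P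
        and the theta sum up to 2M + 1 matches the endpoint of the telescoping sum
        \<open>G\<close>.\<close>
      case (Suc M)
      define P where "P = (gauss_prod (2 * M + 1) :: 'a fps)"
      define \<Theta> where "\<Theta> = sum \<theta> {..2 * M + 1}"
      define S where "S = (\<Sum>n<M. wz_F n 0 :: 'a fps)"
      define E where "E = (\<Sum>n<M. wz_F n M :: 'a fps)"
      define E' where "E' = (\<Sum>j<M. wz_G M j :: 'a fps)"
      define G where "G = (\<Sum>j<M. wz_G 0 j :: 'a fps)"
      have "{n. n \<ge> 1} \<inter> {..<N} = Suc ` {..<M}"
        unfolding Suc lessThan_Suc_eq_insert_0 by auto
      then have S: "sum f ({n. n \<ge> 1} \<inter> {..<N}) = S"
        by (simp add: S_def sum.reindex f_Suc)
      have le: "(fps_X :: 'a fps) ^ N dvd fps_X ^ k" if "M + 1 \<le> k" for k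
        using that Suc by (intro le_imp_power_dvd) simp
      have E: "fps_X ^ N dvd E"
        unfolding E_def by (intro dvd_sum dvd_trans[OF le fps_X_power_dvd_wz_F]) simp
      have E': "fps_X ^ N dvd E'"
        unfolding E'_def wz_G_def by (intro dvd_sum dvd_mult2 dvd_trans[OF le fps_X_power_dvd_wz_F]) simp
      have P: "fps_X ^ N dvd P - (2 * \<Theta> - 1)"
        unfolding P_def \<Theta>_def \<theta>_def assms
        by (rule dvd_trans[OF le gauss_prod_cong_theta]) simp
      have \<Theta>: "fps_X ^ N dvd Z - \<Theta>"
        unfolding \<Theta>_def lessThan_Suc_atMost[symmetric] by (rule dvd_trans[OF le Z]) simp
      have WZ: "S - E = G - E'"
        unfolding S_def E_def G_def E'_def by (rule wz_sum)
      have "2 * G = r * (\<Sum>j<M. gauss_prod (2 * Suc j + 1) - gauss_prod (2 * j + 1))"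
        unfolding G_def sum_distrib_left wz_G_0 r_def assms ..
      also have "\<dots> = r * (P - (1 - q) * i)"
        unfolding sum_lessThan_telescope[of "\<lambda>j. gauss_prod (2 * j + 1)"]
        by (simp add: P_def i_def assms gauss_prod_def)
      \<comment> \<open>The right-hand side collects only errors divisible by
        \<open>fps_X ^ N\<close>. The constants agree because \<open>i - 2 * r * i = - r\<close>, a
        consequence of the equations \<open>r\<close> and \<open>i\<close>.\<close>
      finally have "2 * (r * Z - r * i - S) = r * (2 * (Z - \<Theta>) - (P - (2 * \<Theta> - 1))) - 2 * E + 2 * E'"
        using WZ r i by algebra
      also have "fps_X ^ N dvd \<dots>"
        by (rule dvd_add[OF dvd_diff[OF dvd_mult[OF dvd_diff[OF dvd_mult[OF \<Theta>] P]] dvd_mult[OF E]] dvd_mult[OF E']])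
      finally have "fps_X ^ N dvd 2 * (r * Z - r * i - S)" .
      \<comment> \<open>The factor 2 is a unit and can be cancelled from the divisibility.\<close>
      then show ?thesis
        unfolding S by (subst (asm) fps_X_power_dvd_unit_mult_iff) (simp_all add: fps_numeral_nth)
    qed simp
  qed
  moreover have "1 / (1 - q) * Z - 1 / (1 - q\<^sup>2) = r * Z - r * i"
  proof -
    have "1 - q\<^sup>2 = (1 - q) * (1 + q)"
      by (simp add: algebra_simps power2_eq_square)
    then have "inverse (1 - q\<^sup>2) = r * i"
      by (simp add: fps_inverse_mult r_def i_def)
    then show ?thesis
      by (subst (1 2) fps_divide_unit) (simp_all add: assms r_def)
  qed
  ultimately have "f summable_on {n. n \<ge> 1} \<and> \<theta> summable_on {n. n \<ge> 0} \<and>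
      infsum f {n. n \<ge> 1} = 1 / (1 - q) * infsum \<theta> {n. n \<ge> 0} - 1 / (1 - q\<^sup>2)"
    using \<theta>_sum by (auto simp: Z_def summable_on_def infsumI)
  then show ?thesis unfolding f_def \<theta>_def .
qed

end
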